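(* Let $\alpha>1$ and $s\ge0$. Then $$\varphi_\alpha(s)=\frac1\pi\int_0^{1/\alpha}\left(\frac{x}{1-x}\right)^{\alpha x}\sin(\alpha\pi x)\,e^{-sx}\,dx-\Phi(\alpha,s),$$ where $$\Phi(\alpha,s):=\frac{1}{2\pi i}\int_{\partial D(-1,\,1-1/\alpha)}h_\alpha(z)e^{sz}\,dz,\qquad h_\alpha(z)=\exp(\alpha z\,\mathrm{Log}(1+1/z)).$$ The first term on the right-hand side of the formula for $\varphi_\alpha(s)$ is a completely monotonic function of $s$.
   Context: $\mathrm{Log}$ is the principal logarithm; $h_\alpha$ is defined and holomorphic on $\mathbb{C}\setminus[-1,0]$. $\partial D(a,\rho)$ denotes the positively oriented circle with center $a$ and radius $\rho$. The circle $\partial D(-1,1-1/\alpha)$ meets $[-1,0]$ only at the point $-1/\alpha$, where $h_\alpha$ is not defined; the integral is over the circle with this single point removed. Let $f_\alpha(z)=e^\alpha-h_\alpha(z)$ for $z\in\mathbb{C}\setminus[-1,0]$; $f_\alpha(z)\to e^\alpha-1$ as $z\to0$ within $\mathbb{C}\setminus]-\infty,0]$. The entire function $\varphi_\alpha$ is defined by $$\varphi_\alpha(s)=\frac{1}{2\pi i}\int_{C(r,c)}f_\alpha(z)e^{sz}\,dz,\quad s\in\mathbb{C},$$ where $c>1$, $r>0$ and $C(r,c)$ is the positively oriented boundary of the rectangle with corners $-c\pm ir$, $\pm ir$ (with $f_\alpha(0):=e^\alpha-1$ on the side $[-ir,ir]$); the value does not depend on $c>1$, $r>0$. A completely monotonic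 function is an infinitely differentiable $f:]0,\infty[\to\mathbb{R}$ with $(-1)^nf^{(n)}(x)\ge0$ for all $x>0$, $n=0,1,\ldots$. *)

theory Defs
  imports "HOL-Complex_Analysis.Complex_Analysis"
begin

text \<open>The paper's function lives on the complement of the segment from -1 to 0; on that segment
  the formula below yields conventional values. The two contours used here meet the segment in one
  point each: the circle at -1/\<alpha>, a single point that does not affect the integral over the
  circle, and the rectangle at 0, where the integrand is prescribed separately.\<close>

definition h_fun :: "real \<Rightarrow> complex \<Rightarrow> complex" where
  "h_fun \<alpha> z = exp (of_real \<alpha> * z * Ln (1 + 1 / z))"

definition f_fun :: "real \<Rightarrow> complex \<Rightarrow> complex" where
  "f_fun \<alpha> z = (if z = 0 then exp (of_real \<alpha>) - 1 else exp (of_real \<alpha>) - h_fun \<alpha> z)"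

text \<open>The contour depends on \<open>r > 0\<close> and \<open>c > 1\<close>, and the value does not; they are kept as
  parameters rather than fixed to an arbitrary choice. \<open>rectpath\<close> takes the lower left and the
  upper right corner and is then positively oriented.\<close>

definition phi_fun :: "real \<Rightarrow> real \<Rightarrow> real \<Rightarrow> complex \<Rightarrow> complex" where
  "phi_fun r c \<alpha> s =
     1 / (2 * of_real pi * \<i>) *
       contour_integral (rectpath (Complex (- c) (- r)) (Complex 0 r))
         (\<lambda>z. f_fun \<alpha> z * exp (s * z))"

definition Phi_fun :: "real \<Rightarrow> complex \<Rightarrow> complex" where
  "Phi_fun \<alpha> s =
     1 / (2 * of_real pi * \<i>) *
       contour_integral (circlepath (- 1) (1 - 1 / \<alpha>)) (\<lambda>z. h_fun \<alpha> z * exp (s * z))"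

text \<open>Only the values on the open half-line matter, since derivatives there are local.\<close>

definition completely_monotonic :: "(real \<Rightarrow> real) \<Rightarrow> bool" where
  "completely_monotonic f \<longleftrightarrow>
     (\<forall>n. \<forall>x>0. (deriv ^^ n) f field_differentiable (at x)) \<and>
     (\<forall>n. \<forall>x>0. (- 1) ^ n * (deriv ^^ n) f x \<ge> 0)"

end

theory Submission
  imports Defs "HOL-Real_Asymp.Real_Asymp"
begin

text \<open>
  The integrand \<open>h_fun \<alpha> z = exp (\<alpha> z Log (1 + 1/z))\<close> is holomorphic off the segment from \<open>-1\<close> to
  \<open>0\<close>. Since \<open>z Log (1 + 1/z) \<rightarrow> 0\<close> as \<open>z \<rightarrow> 0\<close>, it stays continuous at the end point \<open>0\<close>,
  whereas at \<open>-1\<close> it grows like \<open>\<bar>z + 1\<bar>\<close> to the power \<open>- \<alpha>\<close>, which is not integrable along the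
  segment. So the rectangle cannot be shrunk to the segment; it is shrunk to a keyhole made of a
  circle around \<open>-1\<close> and the two sides of the segment from the circle to \<open>0\<close>. The boundary values
  at \<open>-x\<close> from above and below are \<open>(x / (1 - x))\<close> to the power \<open>\<alpha> x\<close>, times
  \<open>exp (\<plusminus> \<i> \<pi> \<alpha> x)\<close>; their difference is the sine in the formula, while the circle gives
  \<open>Phi_fun\<close>. The radius \<open>1 - 1/\<alpha>\<close> is special in two ways: the two boundary values agree at
  \<open>x = 1/\<alpha>\<close>, so that the integrand is continuous on the whole circle, and the sine is nonnegative
  on the remaining part of the segment, so that the cut contributes the Laplace transform of a
  nonnegative function. The constant term of \<open>f_fun\<close>, times the entire
  function \<open>exp (s z)\<close>, integrates to zero.

  To deform the contour, the cut of the logarithm is rotated: with the cut along one half of the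
  imaginary axis the integrand becomes a branch that is continuous on a whole closed half plane
  except at \<open>-1\<close> and is holomorphic inside (\<open>isCont_branch\<close>, \<open>branch_exp_regular\<close>). The vertical line
  through \<open>-1\<close> divides each half plane into two quadrants with corner \<open>-1\<close>. As the singularity is an
  extreme point, a quadrant without its corner is still convex (\<open>convex_quadrant\<close>), and Cauchy's
  theorem for convex sets applies with no information on winding numbers (\<open>half_plane_loop\<close>). The
  four loops, with suitable signs, add up to the keyhole (\<open>rectangle_eq_circle_plus_cut\<close>).
\<close>

section \<open>Branches of the integrand\<close>

text \<open>The logarithm of \<open>1 + 1/z\<close> is taken with its cut rotated to the ray \<open>- cnj u\<close> times the
  nonnegative reals, for \<open>\<bar>u\<bar> = 1\<close>; subtracting \<open>Ln u\<close> keeps the value \<open>0\<close> where \<open>1 + 1/z = 1\<close>.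
  The choices \<open>u = 1\<close>, \<open>\<i>\<close> and \<open>- \<i>\<close> give \<open>h_fun\<close> itself and its continuations across the cut from
  above and from below.\<close>

definition branch :: "real \<Rightarrow> complex \<Rightarrow> complex \<Rightarrow> complex" where
  "branch \<alpha> u z = exp (of_real \<alpha> * z * (Ln (u * (1 + 1 / z)) - Ln u))"

lemma h_fun_eq_branch: "h_fun \<alpha> = branch \<alpha> 1"
  by (simp add: fun_eq_iff h_fun_def branch_def)

lemma branch_at_zero: "branch \<alpha> u 0 = 1"
  by (simp add: branch_def)

text \<open>The logarithm grows only like \<open>ln (1/\<bar>z\<bar>)\<close>, uniformly in the direction because imaginary parts
  of logarithms are bounded. Hence the integrand has no jump at \<open>0\<close>, whatever the position of the
  cut, and the rectangle may pass through that point.\<close>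

lemma tendsto_mult_Ln_zero:
  fixes u :: complex
  assumes "norm u = 1"
  shows "((\<lambda>z. z * (Ln (u * (1 + 1 / z)) - Ln u)) \<longlongrightarrow> 0) (at 0)"
proof (rule Lim_null_comparison)
  define g where "g = (\<lambda>t::real. t * (ln (2 / t) + 2 * pi))"
  have "(g \<longlongrightarrow> 0) (at_right 0)"
    unfolding g_def by real_asymp
  moreover have "filterlim norm (at_right 0) (at (0::complex))"
    unfolding filterlim_at by (auto simp: eventually_at_filter intro!: tendsto_eq_intros)
  ultimately show "((\<lambda>z::complex. g (norm z)) \<longlongrightarrow> 0) (at 0)"
    by (rule filterlim_compose)
  have "norm (z * (Ln (u * (1 + 1 / z)) - Ln u)) \<le> g (norm z)"
    if z: "z \<noteq> 0" "norm z < 1 / 2" for z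
  proof -
    define w where "w = u * (1 + 1 / z)"
    have nw: "norm w = norm (1 + 1 / z)"
      using assms by (simp add: w_def norm_mult)
    have inv: "2 < norm (1 / z)"
      using z by (simp add: norm_divide field_simps)
    have low: "1 \<le> norm w"
      using norm_diff_ineq[of "1 / z" 1] inv unfolding nw by (simp add: add.commute)
    have upp: "norm w \<le> 2 / norm z"
      using norm_triangle_ineq[of 1 "1 / z"] inv unfolding nw by (simp add: norm_divide)
    have "w \<noteq> 0" "u \<noteq> 0"
      using low assms by auto
    have "norm (Ln w) \<le> \<bar>Re (Ln w)\<bar> + \<bar>Im (Ln w)\<bar>"
      by (rule cmod_le)
    also have "\<bar>Re (Ln w)\<bar> \<le> ln (2 / norm z)"
      using low upp \<open>w \<noteq> 0\<close> z by simp
    also have "\<bar>Im (Ln w)\<bar> \<le> pi"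
      using mpi_less_Im_Ln[OF \<open>w \<noteq> 0\<close>] Im_Ln_le_pi[OF \<open>w \<noteq> 0\<close>] by linarith
    finally have "norm (Ln w) \<le> ln (2 / norm z) + pi" by simp
    moreover have "norm (Ln u) \<le> pi"
    proof -
      have "norm (Ln u) \<le> \<bar>Re (Ln u)\<bar> + \<bar>Im (Ln u)\<bar>"
        by (rule cmod_le)
      then show ?thesis
        using mpi_less_Im_Ln[OF \<open>u \<noteq> 0\<close>] Im_Ln_le_pi[OF \<open>u \<noteq> 0\<close>] \<open>u \<noteq> 0\<close> assms by simp
    qed
    ultimately have "norm (Ln w - Ln u) \<le> ln (2 / norm z) + 2 * pi"
      using norm_triangle_ineq4[of "Ln w" "Ln u"] by linarith
    then show ?thesis
      unfolding g_def w_def[symmetric] norm_mult by (intro mult_left_mono) auto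
  qed
  moreover have "eventually (\<lambda>z::complex. z \<noteq> 0 \<and> norm z < 1 / 2) (at 0)"
    unfolding eventually_at by (intro exI[of _ "1/2"]) auto
  ultimately show "eventually (\<lambda>z. norm (z * (Ln (u * (1 + 1 / z)) - Ln u)) \<le> g (norm z)) (at 0)"
    by (auto elim: eventually_mono)
qed

lemma isCont_branch_zero:
  assumes "norm u = 1"
  shows "isCont (branch \<alpha> u) 0"
proof -
  have "((\<lambda>z. of_real \<alpha> * (z * (Ln (u * (1 + 1 / z)) - Ln u))) \<longlongrightarrow> of_real \<alpha> * 0) (at 0)"
    by (intro tendsto_intros tendsto_mult_Ln_zero assms)
  then have "((\<lambda>z. exp (of_real \<alpha> * (z * (Ln (u * (1 + 1 / z)) - Ln u)))) \<longlongrightarrow> exp (of_real \<alpha> * 0)) (at 0)"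
    by (rule tendsto_exp)
  then show ?thesis
    unfolding isCont_def branch_def by (simp add: mult.assoc)
qed

lemma field_differentiable_branch:
  assumes "z \<noteq> 0" "u * (1 + 1 / z) \<notin> \<real>\<^sub>\<le>\<^sub>0"
  shows "branch \<alpha> u field_differentiable at z"
  unfolding branch_def field_differentiable_def
  by (rule exI, (rule derivative_eq_intros refl | use assms in force)+)

text \<open>Inversion and the shift by \<open>1\<close> exchange the upper and the lower half plane; the extra quarter
  turn moves the image of the closed half plane \<open>0 \<le> \<sigma> Im z\<close> into the closed right half plane, which
  meets the standard cut only at \<open>0\<close>, the image of \<open>-1\<close>.\<close>

lemma rotated_cut:
  assumes \<sigma>: "\<sigma> \<in> {1, -1 :: real}" and z: "0 \<le> \<sigma> * Im z" "z \<noteq> 0" "z \<noteq> -1"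
  shows "of_real \<sigma> * \<i> * (1 + 1 / z) \<notin> \<real>\<^sub>\<le>\<^sub>0"
proof
  assume "of_real \<sigma> * \<i> * (1 + 1 / z) \<in> \<real>\<^sub>\<le>\<^sub>0"
  then have Re: "- \<sigma> * Im (1 / z) \<le> 0" and Im: "1 + Re (1 / z) = 0"
    using \<sigma> by (auto simp: complex_nonpos_Reals_iff)
  have "0 < (Re z)\<^sup>2 + (Im z)\<^sup>2"
    using \<open>z \<noteq> 0\<close> by (simp add: complex_neq_0)
  then have "Im z = 0"
    using Re z(1) \<sigma> by (auto simp: Im_divide field_simps)
  then show False
    using Im z by (auto simp: Re_divide complex_eq_iff power2_eq_square field_simps)
qed

lemma isCont_branch:
  assumes "\<sigma> \<in> {1, -1}" "0 \<le> \<sigma> * Im z" "z \<noteq> -1"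
  shows "isCont (branch \<alpha> (of_real \<sigma> * \<i>)) z"
proof (cases "z = 0")
  case True
  then show ?thesis
    using assms(1) by (auto intro!: isCont_branch_zero simp: norm_mult)
next
  case False
  then show ?thesis
    using assms by (intro field_differentiable_imp_continuous_at field_differentiable_branch rotated_cut)
qed

lemma isCont_h_fun:
  assumes "Im z = 0 \<longrightarrow> Re z < -1 \<or> 0 \<le> Re z"
  shows "isCont (h_fun \<alpha>) z"
proof (cases "z = 0")
  case True
  then show ?thesis
    by (auto intro!: isCont_branch_zero simp: h_fun_eq_branch)
next
  case False
  have "1 + 1 / z \<notin> \<real>\<^sub>\<le>\<^sub>0"
  proof
    assume "1 + 1 / z \<in> \<real>\<^sub>\<le>\<^sub>0"
    then have *: "1 + Re (1 / z) \<le> 0" "Im (1 / z) = 0"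
      by (auto simp: complex_nonpos_Reals_iff)
    then have "Im z = 0"
      using False by (auto simp: Im_divide complex_eq_iff)
    then have "Re (1 / z) = 1 / Re z" "Re z \<noteq> 0"
      using False by (auto simp: Re_divide power2_eq_square complex_eq_iff)
    with * assms \<open>Im z = 0\<close> show False
      by (auto simp: field_simps)
  qed
  then show ?thesis
    unfolding h_fun_eq_branch using False
    by (intro field_differentiable_imp_continuous_at field_differentiable_branch) auto
qed

section \<open>Boundary values on the cut\<close>

lemma Ln_mult_minus_i:
  assumes "w \<noteq> 0" "0 \<le> Im w"
  shows "Ln (- \<i> * w) = Ln w + Ln (- \<i>)"
proof -
  have "0 \<le> Im (Ln w)" "Im (Ln w) \<le> pi"
    using assms Im_Ln_pos_le[of w] by auto
  moreover have "Im (Ln (- \<i>)) = - pi / 2"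
    by simp
  ultimately show ?thesis
    using assms pi_gt_zero by (subst Ln_times_simple) (linarith | simp)+
qed

lemma Ln_mult_i:
  assumes "w \<noteq> 0" "Im w \<le> 0" "Im w = 0 \<longrightarrow> 0 < Re w"
  shows "Ln (\<i> * w) = Ln w + Ln \<i>"
proof -
  have "Im (Ln w) \<le> 0"
    using assms Im_Ln_pos_lt[of w] Im_Ln_eq_0[of w] Im_Ln_eq_pi[of w] Im_Ln_le_pi[of w]
    by (smt (verit))
  then show ?thesis
    using assms mpi_less_Im_Ln[of w] by (subst Ln_times_simple) auto
qed

text \<open>From below there is agreement on the segment as well: there \<open>1 + 1/z\<close> is negative, and \<open>Ln\<close>
  continues onto its cut from the upper half plane, which is the image of the lower one.\<close>

lemma branch_minus_i_eq_h:
  assumes "0 \<ge> Im z" "z \<noteq> -1"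
  shows "branch \<alpha> (- \<i>) z = h_fun \<alpha> z"
proof (cases "z = 0")
  case False
  have "1 + 1 / z \<noteq> 0"
    using False \<open>z \<noteq> -1\<close> by (auto simp: field_simps add_eq_0_iff)
  moreover have "0 \<le> Im (1 + 1 / z)"
    using assms by (simp add: Im_divide divide_nonpos_nonneg)
  ultimately show ?thesis
    unfolding branch_def h_fun_def by (subst Ln_mult_minus_i) auto
qed (simp add: branch_at_zero h_fun_def)

lemma branch_i_eq_h:
  assumes "0 \<le> Im z" and real: "Im z = 0 \<longrightarrow> Re z < -1 \<or> 0 \<le> Re z"
  shows "branch \<alpha> \<i> z = h_fun \<alpha> z"
proof (cases "z = 0")
  case False
  have "z \<noteq> -1"
    using real by auto
  have "1 + 1 / z \<noteq> 0"
    using False \<open>z \<noteq> -1\<close> by (auto simp: field_simps add_eq_0_iff)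
  moreover have "Im (1 + 1 / z) \<le> 0"
    using assms by (simp add: Im_divide)
  moreover have "0 < Re (1 + 1 / z)" if "Im (1 + 1 / z) = 0"
  proof -
    have "Im z = 0"
      using that False by (auto simp: Im_divide complex_eq_iff)
    then have "Re (1 + 1 / z) = 1 + 1 / Re z" "Re z \<noteq> 0"
      using False by (auto simp: Re_divide power2_eq_square complex_eq_iff)
    then show ?thesis
      using real \<open>Im z = 0\<close> by (auto simp: add_divide_eq_iff zero_less_divide_iff)
  qed
  ultimately show ?thesis
    unfolding branch_def h_fun_def by (subst Ln_mult_i) auto
qed (simp add: branch_at_zero h_fun_def)

lemma branch_on_cut:
  assumes \<sigma>: "\<sigma> \<in> {1, -1 :: real}" and x: "0 < x" "x < 1"
  shows "branch \<alpha> (of_real \<sigma> * \<i>) (- of_real x) =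
           of_real ((x / (1 - x)) powr (\<alpha> * x)) * cis (\<sigma> * \<alpha> * pi * x)"
proof -
  define q where "q = (1 - x) / x"
  have "q > 0"
    using x by (simp add: q_def)
  have w: "of_real \<sigma> * \<i> * (1 + 1 / (- of_real x)) = of_real q * (- of_real \<sigma> * \<i>)"
    using x by (simp add: q_def field_simps)
  have "Ln (of_real q * (- of_real \<sigma> * \<i>)) = of_real (ln q) + Ln (- of_real \<sigma> * \<i>)"
    using \<sigma> \<open>q > 0\<close> by (subst Ln_times_of_real) (auto simp: Ln_of_real)
  moreover have "Ln (- of_real \<sigma> * \<i>) - Ln (of_real \<sigma> * \<i>) = - of_real \<sigma> * of_real pi * \<i>"
    using \<sigma> by auto
  ultimately have log: "Ln (of_real q * (- of_real \<sigma> * \<i>)) - Ln (of_real \<sigma> * \<i>) = of_real (ln q) - of_real \<sigma> * of_real pi * \<i>"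
    by (simp add: algebra_simps)
  have "(x / (1 - x)) powr (\<alpha> * x) = exp (- \<alpha> * x * ln q)"
    using x by (simp add: powr_def q_def ln_div algebra_simps)
  then have "of_real ((x / (1 - x)) powr (\<alpha> * x)) * cis (\<sigma> * \<alpha> * pi * x)
      = exp (of_real (- \<alpha> * x * ln q) + \<i> * of_real (\<sigma> * \<alpha> * pi * x))"
    by (simp only: cis_conv_exp exp_of_real [symmetric] exp_add)
  then show ?thesis
    unfolding branch_def w log by (simp add: algebra_simps)
qed

text \<open>The two boundary values at \<open>-x\<close> differ by the factor \<open>exp (2 \<pi> \<i> \<alpha> x)\<close>, which is \<open>1\<close> at the point
  where the circle meets the segment.\<close>

lemma branch_i_eq_h_crossing:
  assumes "\<alpha> > 1"
  shows "branch \<alpha> \<i> (- of_real (1 / \<alpha>)) = h_fun \<alpha> (- of_real (1 / \<alpha>))"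
proof -
  have "h_fun \<alpha> (- of_real (1 / \<alpha>)) = branch \<alpha> (- \<i>) (- of_real (1 / \<alpha>))"
    using assms by (intro branch_minus_i_eq_h [symmetric]) (auto simp: complex_eq_iff)
  then show ?thesis
    using branch_on_cut[of 1 "1 / \<alpha>" \<alpha>] branch_on_cut[of "-1" "1 / \<alpha>" \<alpha>] assms
    by (simp add: complex_eq_iff)
qed

lemma branch_eq_h_on_contours:
  assumes "\<alpha> > 1" "\<sigma> \<in> {1, -1 :: real}" "0 \<le> \<sigma> * Im z" "z \<noteq> -1"
    and "Im z = 0 \<longrightarrow> Re z < -1 \<or> 0 \<le> Re z \<or> z = - of_real (1 / \<alpha>)"
  shows "branch \<alpha> (of_real \<sigma> * \<i>) z = h_fun \<alpha> z"
proof (cases "z = - of_real (1 / \<alpha>)")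
  case True
  then show ?thesis
    using assms branch_i_eq_h_crossing[of \<alpha>] branch_minus_i_eq_h[of z \<alpha>] by auto
next
  case False
  then show ?thesis
    using assms branch_i_eq_h[of z \<alpha>] branch_minus_i_eq_h[of z \<alpha>] by auto
qed

section \<open>Cauchy's theorem in the four quadrants at -1\<close>

definition quadrant :: "real \<Rightarrow> real \<Rightarrow> complex set" where
  "quadrant \<sigma> \<tau> = {z. 0 \<le> \<sigma> * Im z \<and> 0 \<le> \<tau> * (Re z + 1) \<and> z \<noteq> -1}"

text \<open>The missing corner is an extreme point of the closed quadrant: an affine function that is positive
  on the rest of the quadrant vanishes there.\<close>

lemma convex_quadrant:
  assumes "\<sigma> \<in> {1, -1}" "\<tau> \<in> {1, -1}"
  shows "convex (quadrant \<sigma> \<tau>)"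
proof (rule convexI)
  fix x y :: complex and u v :: real
  assume xy: "x \<in> quadrant \<sigma> \<tau>" "y \<in> quadrant \<sigma> \<tau>" and uv: "0 \<le> u" "0 \<le> v" "u + v = 1"
  \<comment> \<open>The corner is the only point of the closed quadrant at which \<open>l\<close> vanishes.\<close>
  define l where "l z = \<sigma> * Im z + \<tau> * (Re z + 1)" for z
  have pos: "z \<in> quadrant \<sigma> \<tau> \<longleftrightarrow> 0 \<le> \<sigma> * Im z \<and> 0 \<le> \<tau> * (Re z + 1) \<and> 0 < l z" for z
    using assms unfolding quadrant_def l_def by (auto simp: complex_eq_iff)
  have Im: "\<sigma> * Im (u *\<^sub>R x + v *\<^sub>R y) = u * (\<sigma> * Im x) + v * (\<sigma> * Im y)"
    by (simp add: algebra_simps)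
  have "\<tau> * (Re (u *\<^sub>R x + v *\<^sub>R y) + 1) = \<tau> * (Re (u *\<^sub>R x + v *\<^sub>R y) + (u + v))"
    using uv by simp
  also have "\<dots> = u * (\<tau> * (Re x + 1)) + v * (\<tau> * (Re y + 1))"
    by (simp add: algebra_simps)
  finally have Re: "\<tau> * (Re (u *\<^sub>R x + v *\<^sub>R y) + 1) = u * (\<tau> * (Re x + 1)) + v * (\<tau> * (Re y + 1))" .
  have "l (u *\<^sub>R x + v *\<^sub>R y) = u * l x + v * l y"
    unfolding l_def Im Re by (simp add: algebra_simps)
  moreover have "0 < u * l x + v * l y"
    using xy uv unfolding pos
    by (cases "u = 0") (auto intro: add_pos_nonneg)
  ultimately show "u *\<^sub>R x + v *\<^sub>R y \<in> quadrant \<sigma> \<tau>"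
    using xy uv unfolding pos Im Re by auto
qed

text \<open>The loops below consist of a quarter circle followed by four segments, of which the last one
  returns to the start of the arc. The integrand need only be continuous at the boundary, where the
  loops touch the cut.\<close>

lemma convex_loop_integral:
  assumes S: "convex S" "continuous_on S g" "\<And>z. z \<in> interior S \<Longrightarrow> g field_differentiable at z"
    and \<gamma>: "valid_path \<gamma>" "path_image \<gamma> \<subseteq> S"
    and abc: "pathfinish \<gamma> = b" "pathstart \<gamma> = a" "c \<in> S" "d \<in> S" "e \<in> S"
  shows "contour_integral \<gamma> g + contour_integral (linepath b c) g + contour_integral (linepath c d) g
           + contour_integral (linepath d e) g + contour_integral (linepath e a) g = 0"
proof -
  have ab: "a \<in> S" "b \<in> S"
    using \<gamma> abc by auto
  have seg: "closed_segment x y \<subseteq> S" if "x \<in> S" "y \<in> S" for x y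
    using that S(1) by (simp add: closed_segment_subset)
  have int_line: "g contour_integrable_on linepath x y" if "x \<in> S" "y \<in> S" for x y
    using seg[OF that] S(2) by (meson contour_integrable_continuous_linepath continuous_on_subset)
  have Cauchy: "(g has_contour_integral 0) p"
    if "valid_path p" "path_image p \<subseteq> S" "pathfinish p = pathstart p" for p
    using Cauchy_theorem_convex[OF S(2,1), of "{}" p] S(3) that by auto
  have arc: "g contour_integrable_on \<gamma>"
  proof -
    obtain F where "\<And>z. z \<in> S \<Longrightarrow> (F has_field_derivative g z) (at z within S)"
      using holomorphic_convex_primitive[OF S(1), of "{}" g] S(2,3) by auto
    then show ?thesis
      using \<gamma> contour_integral_primitive contour_integrable_on_def by blast
  qed
  have "(g has_contour_integral 0)
          (\<gamma> +++ linepath b c +++ linepath c d +++ linepath d e +++ linepath e a)"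
    using \<gamma> abc ab seg
    by (intro Cauchy) (auto simp: path_image_join intro!: valid_path_join)
  then show ?thesis
    using arc \<gamma> abc ab int_line
    by (auto dest!: contour_integral_unique simp: add.assoc)
qed

lemma branch_exp_regular:
  fixes \<alpha> :: real and s :: complex
  assumes \<sigma>: "\<sigma> \<in> {1, -1}" and \<tau>: "\<tau> \<in> {1, -1}"
  defines "g \<equiv> (\<lambda>z. branch \<alpha> (of_real \<sigma> * \<i>) z * exp (s * z))"
  shows "continuous_on (quadrant \<sigma> \<tau>) g"
    and "\<And>z. z \<in> interior (quadrant \<sigma> \<tau>) \<Longrightarrow> g field_differentiable at z"
proof -
  show "continuous_on (quadrant \<sigma> \<tau>) g"
    unfolding g_def using \<sigma>
    by (intro continuous_at_imp_continuous_on ballI continuous_mult isCont_branch)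
       (auto simp: quadrant_def intro!: continuous_intros)
  fix z assume z: "z \<in> interior (quadrant \<sigma> \<tau>)"
  have "interior (quadrant \<sigma> \<tau>) \<subseteq> interior {z. 0 \<le> \<sigma> * Im z}"
    by (rule interior_mono) (auto simp: quadrant_def)
  also have "interior {z. 0 \<le> \<sigma> * Im z} = {z. 0 < \<sigma> * Im z}"
    using \<sigma> interior_halfspace_ge[of "of_real \<sigma> * \<i>" 0]
    by (auto simp: inner_complex_def)
  finally have "0 < \<sigma> * Im z" using z by auto
  moreover have "(\<lambda>z. exp (s * z)) field_differentiable at z"
    unfolding field_differentiable_def by (rule exI, (rule derivative_eq_intros refl)+)
  ultimately show "g field_differentiable at z"
    unfolding g_def using \<sigma>
    by (intro field_differentiable_mult field_differentiable_branch rotated_cut) auto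
qed

section \<open>Contour integrals over rectangles and arcs\<close>

lemma contour_integrable_continuous_rectpath:
  assumes "continuous_on (path_image (rectpath a b)) f"
  shows "f contour_integrable_on rectpath a b"
  using assms unfolding rectpath_def Let_def
  by (intro contour_integrable_joinI contour_integrable_continuous_linepath valid_path_join)
     (auto simp: path_image_join elim!: continuous_on_subset)

lemma contour_integral_rectpath:
  assumes "continuous_on (path_image (rectpath (Complex x y) (Complex x' y'))) f"
  shows "contour_integral (rectpath (Complex x y) (Complex x' y')) f =
    contour_integral (linepath (Complex x y) (Complex x' y)) f
    + contour_integral (linepath (Complex x' y) (Complex x' y')) f
    + contour_integral (linepath (Complex x' y') (Complex x y')) f
    + contour_integral (linepath (Complex x y') (Complex x y)) f"
  using contour_integrable_continuous_rectpath[OF assms] unfolding rectpath_def Let_def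
  by (simp add: add.assoc)

lemma subpath_part_circlepath:
  "subpath u v (part_circlepath z r a b) = part_circlepath z r (linepath a b u) (linepath a b v)"
  by (simp add: subpath_def part_circlepath_def linepath_def fun_eq_iff algebra_simps)

lemma contour_integral_part_circlepath_halve:
  assumes "f contour_integrable_on part_circlepath z r a b"
  shows "contour_integral (part_circlepath z r a b) f =
           contour_integral (part_circlepath z r a ((a + b) / 2)) f
           + contour_integral (part_circlepath z r ((a + b) / 2) b) f"
  using contour_integral_subpath_combine[OF assms valid_path_part_circlepath, of 0 "1/2" 1]
  by (simp add: subpath_part_circlepath linepath_def add_divide_distrib)

lemma part_circlepath_periodic:
  "part_circlepath z r (a + 2 * pi) (b + 2 * pi) = part_circlepath z r a b"
proof
  fix t
  have "linepath (a + 2 * pi) (b + 2 * pi) t = linepath a b t + 2 * pi"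
    by (simp add: linepath_def algebra_simps)
  then show "part_circlepath z r (a + 2 * pi) (b + 2 * pi) t = part_circlepath z r a b t"
    by (simp only: part_circlepath_def cis_conv_exp [symmetric]) (simp add: complex_eq_iff)
qed

lemma arc_point_polar:
  assumes "z \<in> path_image (part_circlepath (-1) \<rho> (\<sigma> * a) (\<sigma> * b))" "a \<le> b"
    and \<sigma>: "\<sigma> \<in> {1, -1 :: real}" and "0 < \<rho>"
  shows "\<exists>t\<in>{a..b}. \<sigma> * Im z = \<rho> * sin t \<and> Re z + 1 = \<rho> * cos t \<and> z \<noteq> -1"
proof -
  have "closed_segment (\<sigma> * a) (\<sigma> * b) = (\<lambda>t. \<sigma> * t) ` {a..b}"
    using \<sigma> \<open>a \<le> b\<close> by (auto simp: closed_segment_eq_real_ivl)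
  then obtain t where t: "t \<in> {a..b}" "z = -1 + of_real \<rho> * cis (\<sigma> * t)"
    using assms(1) by (auto simp: path_image_part_circlepath')
  moreover have "z \<noteq> -1"
    using t(2) \<open>0 < \<rho>\<close> by simp
  ultimately show ?thesis
    using \<sigma> by (intro bexI[of _ t]) auto
qed

section \<open>Loops in the upper and the lower half plane\<close>

text \<open>Half of the keyhole: the half circle from \<open>\<rho> - 1\<close> to \<open>-1 - \<rho>\<close>, out to the rectangle along the real
  axis, around its upper (or lower) half to \<open>0\<close> and back along the cut. It is the sum of a loop in each
  of the two quadrants; the vertical segment from \<open>m\<close> to \<open>n\<close> on their common side is traversed in both
  directions.\<close>

lemma half_plane_loop:
  fixes \<alpha> :: real and s :: complex
  assumes \<sigma>: "\<sigma> \<in> {1, -1 :: real}" and \<rho>: "0 < \<rho>" "\<rho> < 1" and r: "r > 0" and c: "c > 1"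
  defines "g \<equiv> (\<lambda>z. branch \<alpha> (of_real \<sigma> * \<i>) z * exp (s * z))"
  shows "contour_integral (part_circlepath (-1) \<rho> 0 (\<sigma> * pi)) g
           + contour_integral (linepath (Complex (-1 - \<rho>) 0) (Complex (- c) 0)) g
           + contour_integral (linepath (Complex (- c) 0) (Complex (- c) (\<sigma> * r))) g
           + contour_integral (linepath (Complex (- c) (\<sigma> * r)) (Complex 0 (\<sigma> * r))) g
           + contour_integral (linepath (Complex 0 (\<sigma> * r)) 0) g
           + contour_integral (linepath 0 (Complex (\<rho> - 1) 0)) g = 0"
proof -
  note reg = branch_exp_regular[OF \<sigma>, where \<alpha> = \<alpha> and s = s, folded g_def]
  have cont: "continuous_on {z. 0 \<le> \<sigma> * Im z \<and> z \<noteq> -1} g"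
    unfolding g_def using \<sigma>
    by (intro continuous_at_imp_continuous_on ballI continuous_mult isCont_branch)
       (auto intro!: continuous_intros)
  have cis_\<sigma>: "cis (\<sigma> * pi / 2) = of_real \<sigma> * \<i>" "cis (\<sigma> * pi) = -1"
    using \<sigma> by (auto simp: complex_eq_iff)
  note arc_point = arc_point_polar[OF _ _ \<sigma> \<rho>(1)]
  have right: "path_image (part_circlepath (-1) \<rho> 0 (\<sigma> * pi / 2)) \<subseteq> quadrant \<sigma> 1"
  proof
    fix z assume "z \<in> path_image (part_circlepath (-1) \<rho> 0 (\<sigma> * pi / 2))"
    then obtain t where t: "0 \<le> t" "t \<le> pi / 2" "\<sigma> * Im z = \<rho> * sin t" "Re z + 1 = \<rho> * cos t" "z \<noteq> -1"
      using arc_point[of z 0 "pi / 2"] by auto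
    then have "0 \<le> sin t" "0 \<le> cos t"
      by (auto intro!: sin_ge_zero cos_ge_zero)
    then show "z \<in> quadrant \<sigma> 1"
      using t \<rho> by (simp add: quadrant_def)
  qed
  have left: "path_image (part_circlepath (-1) \<rho> (\<sigma> * pi / 2) (\<sigma> * pi)) \<subseteq> quadrant \<sigma> (-1)"
  proof
    fix z assume "z \<in> path_image (part_circlepath (-1) \<rho> (\<sigma> * pi / 2) (\<sigma> * pi))"
    then obtain t where t: "pi / 2 \<le> t" "t \<le> pi" "\<sigma> * Im z = \<rho> * sin t" "Re z + 1 = \<rho> * cos t" "z \<noteq> -1"
      using arc_point[of z "pi / 2" pi] by auto
    then have "0 \<le> sin t" "cos t \<le> 0"
      using cos_monotone_0_pi_le[of "pi / 2" t] by (auto intro!: sin_ge_zero)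
    then show "z \<in> quadrant \<sigma> (-1)"
      using t \<rho> mult_nonneg_nonpos[of \<rho> "cos t"] by (simp add: quadrant_def)
  qed
  have arc: "path_image (part_circlepath (-1) \<rho> 0 (\<sigma> * pi)) \<subseteq> {z. 0 \<le> \<sigma> * Im z \<and> z \<noteq> -1}"
  proof
    fix z assume "z \<in> path_image (part_circlepath (-1) \<rho> 0 (\<sigma> * pi))"
    then obtain t where "0 \<le> t" "t \<le> pi" "\<sigma> * Im z = \<rho> * sin t" "z \<noteq> -1"
      using arc_point[of z 0 pi] by auto
    then show "z \<in> {z. 0 \<le> \<sigma> * Im z \<and> z \<noteq> -1}"
      using \<rho> sin_ge_zero[of t] by simp
  qed
  define p where "p = Complex (\<rho> - 1) 0"
  define m where "m = Complex (-1) (\<sigma> * \<rho>)"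
  define n where "n = Complex (-1) (\<sigma> * r)"
  have ends:
    "pathstart (part_circlepath (-1) \<rho> 0 (\<sigma> * pi / 2)) = p"
    "pathfinish (part_circlepath (-1) \<rho> 0 (\<sigma> * pi / 2)) = m"
    "pathstart (part_circlepath (-1) \<rho> (\<sigma> * pi / 2) (\<sigma> * pi)) = m"
    "pathfinish (part_circlepath (-1) \<rho> (\<sigma> * pi / 2) (\<sigma> * pi)) = Complex (-1 - \<rho>) 0"
    by (simp_all only: pathstart_part_circlepath pathfinish_part_circlepath cis_conv_exp [symmetric] cis_\<sigma> cis_zero)
       (simp_all add: m_def p_def complex_eq_iff)
  have right_loop: "contour_integral (part_circlepath (-1) \<rho> 0 (\<sigma> * pi / 2)) g
        + contour_integral (linepath m n) g
        + contour_integral (linepath n (Complex 0 (\<sigma> * r))) g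
        + contour_integral (linepath (Complex 0 (\<sigma> * r)) 0) g
        + contour_integral (linepath 0 p) g = 0"
  proof (rule convex_loop_integral[OF convex_quadrant[OF \<sigma>] reg valid_path_part_circlepath right ends(2,1)])
    show "n \<in> quadrant \<sigma> 1" "Complex 0 (\<sigma> * r) \<in> quadrant \<sigma> 1" "0 \<in> quadrant \<sigma> 1"
      using \<sigma> r by (auto simp: n_def quadrant_def complex_eq_iff)
  qed auto
  have left_loop: "contour_integral (part_circlepath (-1) \<rho> (\<sigma> * pi / 2) (\<sigma> * pi)) g
        + contour_integral (linepath (Complex (-1 - \<rho>) 0) (Complex (- c) 0)) g
        + contour_integral (linepath (Complex (- c) 0) (Complex (- c) (\<sigma> * r))) g
        + contour_integral (linepath (Complex (- c) (\<sigma> * r)) n) g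
        + contour_integral (linepath n m) g = 0"
  proof (rule convex_loop_integral[OF convex_quadrant[OF \<sigma>] reg valid_path_part_circlepath left ends(4,3)])
    show "Complex (- c) 0 \<in> quadrant \<sigma> (-1)" "Complex (- c) (\<sigma> * r) \<in> quadrant \<sigma> (-1)" "n \<in> quadrant \<sigma> (-1)"
      using \<sigma> r c by (auto simp: n_def quadrant_def complex_eq_iff)
  qed auto
  have halves: "contour_integral (part_circlepath (-1) \<rho> 0 (\<sigma> * pi)) g =
          contour_integral (part_circlepath (-1) \<rho> 0 (\<sigma> * pi / 2)) g
          + contour_integral (part_circlepath (-1) \<rho> (\<sigma> * pi / 2) (\<sigma> * pi)) g"
    using contour_integral_part_circlepath_halve[of g "-1" \<rho> 0 "\<sigma> * pi"] arc cont
    by (auto intro: contour_integrable_continuous_part_circlepath continuous_on_subset)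
  have side: "closed_segment (Complex (- c) (\<sigma> * r)) (Complex 0 (\<sigma> * r)) = 
      {z. Im z = \<sigma> * r \<and> Re z \<in> {-c..0}}"
    using c by (subst closed_segment_same_Im) (auto simp: closed_segment_eq_real_ivl)
  have "contour_integral (linepath (Complex (- c) (\<sigma> * r)) (Complex 0 (\<sigma> * r))) g =
          contour_integral (linepath (Complex (- c) (\<sigma> * r)) n) g
          + contour_integral (linepath n (Complex 0 (\<sigma> * r))) g"
  proof (rule contour_integral_split_linepath)
    show "continuous_on (closed_segment (Complex (- c) (\<sigma> * r)) (Complex 0 (\<sigma> * r))) g"
      using \<sigma> r unfolding side by (intro continuous_on_subset[OF cont]) auto
    show "n \<in> closed_segment (Complex (- c) (\<sigma> * r)) (Complex 0 (\<sigma> * r))"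
      using c unfolding side by (auto simp: n_def)
  qed
  moreover have "contour_integral (linepath n m) g = - contour_integral (linepath m n) g"
    using contour_integral_reversepath[of "linepath m n" g] by simp
  ultimately show ?thesis
    using arg_cong2[OF right_loop left_loop, of "(+)"] halves unfolding p_def by (simp add: algebra_simps)
qed

section \<open>From the rectangle to the circle\<close>

lemma continuous_on_rectpath_h_exp:
  fixes s :: complex
  assumes "r > 0" "c > 1"
  shows "continuous_on (path_image (rectpath (Complex (- c) (- r)) (Complex 0 r))) (\<lambda>z. h_fun \<alpha> z * exp (s * z))"
proof -
  define R where "R = rectpath (Complex (- c) (- r)) (Complex 0 r)"
  have "path_image R = {z. Re z \<in> {-c, 0} \<and> Im z \<in> {-r..r}} \<union> {z. Im z \<in> {-r, r} \<and> Re z \<in> {-c..0}}"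
    using assms unfolding R_def by (subst path_image_rectpath) auto
  then have "Im z = 0 \<longrightarrow> Re z < -1 \<or> 0 \<le> Re z" if "z \<in> path_image R" for z
    using that assms by auto
  then show ?thesis
    unfolding R_def [symmetric]
    by (intro continuous_at_imp_continuous_on ballI continuous_mult isCont_h_fun)
       (auto intro!: continuous_intros)
qed

text \<open>The loop in the lower half plane minus the loop in the upper one. The parts on the real axis left
  of the circle cancel because both branches equal \<open>h_fun\<close> there; on the cut the branches differ, and
  these integrals remain.\<close>

lemma rectangle_eq_circle_plus_cut:
  fixes \<alpha> r c :: real and s :: complex
  assumes \<alpha>: "\<alpha> > 1" and r: "r > 0" and c: "c > 1"
  shows "contour_integral (rectpath (Complex (- c) (- r)) (Complex 0 r)) (\<lambda>z. h_fun \<alpha> z * exp (s * z))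
    = contour_integral (circlepath (-1) (1 - 1 / \<alpha>)) (\<lambda>z. h_fun \<alpha> z * exp (s * z))
      + contour_integral (linepath (of_real (- (1 / \<alpha>))) 0) (\<lambda>z. branch \<alpha> (- \<i>) z * exp (s * z))
      - contour_integral (linepath (of_real (- (1 / \<alpha>))) 0) (\<lambda>z. branch \<alpha> \<i> z * exp (s * z))"
    (is "contour_integral ?rect ?H = contour_integral ?circ _ + _ - _")
proof -
  define \<rho> where "\<rho> = 1 - 1 / \<alpha>"
  have \<rho>: "0 < \<rho>" "\<rho> < 1"
    using \<alpha> by (auto simp: \<rho>_def)
  define g where "g \<sigma> = (\<lambda>z. branch \<alpha> (of_real \<sigma> * \<i>) z * exp (s * z))" for \<sigma> :: real
  have g_eq: "g \<sigma> z = ?H z"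
    if "\<sigma> \<in> {1, -1}" "0 \<le> \<sigma> * Im z" "z \<noteq> -1"
      "Im z = 0 \<longrightarrow> Re z < -1 \<or> 0 \<le> Re z \<or> z = - of_real (1 / \<alpha>)" for \<sigma> z
    using branch_eq_h_on_contours[OF \<alpha> that] by (simp add: g_def)
  have on_circle: "Re z < -1 \<or> z = - of_real (1 / \<alpha>)" if "z \<in> sphere (-1) \<rho>" "Im z = 0" for z
  proof -
    have "\<bar>Re z + 1\<bar> = \<rho>"
      using that cmod_eq_Re[of "z + 1"] by (simp add: dist_norm norm_minus_commute[of "-1"])
    then show ?thesis
      using \<rho> that(2) unfolding \<rho>_def by (auto simp: complex_eq_iff)
  qed
  have g_eq_circle: "g \<sigma> z = ?H z" if "\<sigma> \<in> {1, -1}" "0 \<le> \<sigma> * Im z" "z \<in> sphere (-1) \<rho>" for \<sigma> z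
    using that \<rho> on_circle by (intro g_eq) auto
  have cont_H: "continuous_on A ?H" if "\<And>z. z \<in> A \<Longrightarrow> Im z = 0 \<longrightarrow> Re z < -1 \<or> 0 \<le> Re z" for A
    using that
    by (intro continuous_at_imp_continuous_on ballI continuous_mult isCont_h_fun)
       (auto intro!: continuous_intros)
  \<comment> \<open>Each closed half circle carries one of the two branches, and these agree at the crossing point.\<close>
  have cont_circle: "continuous_on (sphere (-1) \<rho>) ?H"
  proof -
    have half: "continuous_on (sphere (-1) \<rho> \<inter> {z. 0 \<le> \<sigma> * Im z}) ?H" if "\<sigma> \<in> {1, -1}" for \<sigma>
    proof (rule continuous_on_eq)
      show "continuous_on (sphere (-1) \<rho> \<inter> {z. 0 \<le> \<sigma> * Im z}) (g \<sigma>)"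
        unfolding g_def using that \<rho>
        by (intro continuous_at_imp_continuous_on ballI continuous_mult isCont_branch)
           (auto intro!: continuous_intros)
    qed (use that g_eq_circle in auto)
    have closed: "closed {z. 0 \<le> \<sigma> * Im z}" for \<sigma>
      by (intro closed_Collect_le continuous_intros)
    have "continuous_on (sphere (-1) \<rho> \<inter> {z. 0 \<le> 1 * Im z} \<union> sphere (-1) \<rho> \<inter> {z. 0 \<le> -1 * Im z}) ?H"
      by (intro continuous_on_closed_Un half closed_Int closed) auto
    moreover have "sphere (-1) \<rho> \<inter> {z. 0 \<le> 1 * Im z} \<union> sphere (-1) \<rho> \<inter> {z. 0 \<le> -1 * Im z} = sphere (-1) \<rho>"
      by auto
    ultimately show ?thesis by simp
  qed
  \<comment> \<open>The lower half circle is traversed from \<open>0\<close> to \<open>- \<pi>\<close>, so that both half planes are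
    treated alike.\<close>
  have circle: "contour_integral ?circ ?H =
      contour_integral (part_circlepath (-1) \<rho> 0 pi) ?H - contour_integral (part_circlepath (-1) \<rho> 0 (- pi)) ?H"
  proof -
    have "?H contour_integrable_on part_circlepath (-1) \<rho> 0 (2 * pi)"
      using cont_circle \<rho> path_image_circlepath[of "-1" \<rho>] unfolding circlepath_def
      by (intro contour_integrable_continuous_part_circlepath) auto
    then have "contour_integral ?circ ?H = contour_integral (part_circlepath (-1) \<rho> 0 pi) ?H
        + contour_integral (part_circlepath (-1) \<rho> pi (2 * pi)) ?H"
      using contour_integral_part_circlepath_halve[of ?H "-1" \<rho> 0 "2 * pi"]
      by (simp add: circlepath_def \<rho>_def)
    also have "part_circlepath (-1) \<rho> pi (2 * pi) = part_circlepath (-1) \<rho> (- pi) 0"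
      using part_circlepath_periodic[of "-1" \<rho> "- pi" 0] by simp
    also have "contour_integral \<dots> ?H = - contour_integral (part_circlepath (-1) \<rho> 0 (- pi)) ?H"
      by (rule contour_integral_part_circlepath_reverse)
    finally show ?thesis by simp
  qed
  have seg_Im: "closed_segment (Complex x y) (Complex x' y) = {z. Im z = y \<and> Re z \<in> closed_segment x x'}" for x x' y
    by (subst closed_segment_same_Im) auto
  have seg_Re: "closed_segment (Complex x y) (Complex x y') = {z. Re z = x \<and> Im z \<in> closed_segment y y'}" for x y y'
    by (subst closed_segment_same_Re) auto
  have zero: "0 = Complex 0 0"
    by (simp add: complex_eq_iff)
  define I where "I a b = contour_integral (linepath a b) ?H" for a b
  have I_rev: "I a b = - I b a" for a b
    using contour_integral_reversepath[of "linepath b a" ?H] by (simp add: I_def)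
  define cut where "cut \<sigma> = contour_integral (linepath 0 (Complex (\<rho> - 1) 0)) (g \<sigma>)" for \<sigma>
  define loop where "loop \<sigma> = contour_integral (part_circlepath (-1) \<rho> 0 (\<sigma> * pi)) ?H
       + I (Complex (-1 - \<rho>) 0) (Complex (- c) 0) + I (Complex (- c) 0) (Complex (- c) (\<sigma> * r))
       + I (Complex (- c) (\<sigma> * r)) (Complex 0 (\<sigma> * r)) + I (Complex 0 (\<sigma> * r)) 0 + cut \<sigma>" for \<sigma>
  have loop: "loop \<sigma> = 0"
    if \<sigma>: "\<sigma> \<in> {1, -1}" for \<sigma>
  proof -
    have "contour_integral (part_circlepath (-1) \<rho> 0 (\<sigma> * pi)) (g \<sigma>) = contour_integral (part_circlepath (-1) \<rho> 0 (\<sigma> * pi)) ?H"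
    proof (intro contour_integral_eq g_eq_circle \<sigma>)
      fix z assume z: "z \<in> path_image (part_circlepath (-1) \<rho> 0 (\<sigma> * pi))"
      then show "0 \<le> \<sigma> * Im z"
        using arc_point_polar[of z \<rho> \<sigma> 0 pi] \<sigma> \<rho>
        by (metis atLeastAtMost_iff less_imp_le mult_nonneg_nonneg mult_zero_right pi_ge_zero sin_ge_zero)
      show "z \<in> sphere (-1) \<rho>"
        using z path_image_part_circlepath_subset'[of \<rho> "-1" 0 "\<sigma> * pi"] \<rho> by auto
    qed
    moreover have line: "contour_integral (linepath a b) (g \<sigma>) = I a b"
      if "\<And>z. z \<in> closed_segment a b \<Longrightarrow> 0 \<le> \<sigma> * Im z \<and> (Im z = 0 \<longrightarrow> Re z < -1 \<or> 0 \<le> Re z)" for a b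
      unfolding I_def using that \<sigma> by (intro contour_integral_eq g_eq) fastforce+
    moreover have "contour_integral (linepath (Complex (-1 - \<rho>) 0) (Complex (- c) 0)) (g \<sigma>)
        = I (Complex (-1 - \<rho>) 0) (Complex (- c) 0)"
      using c \<rho> by (intro line) (auto simp: seg_Im closed_segment_eq_real_ivl split: if_splits)
    moreover have "contour_integral (linepath (Complex (- c) 0) (Complex (- c) (\<sigma> * r))) (g \<sigma>)
        = I (Complex (- c) 0) (Complex (- c) (\<sigma> * r))"
      using c r \<sigma> by (intro line) (auto simp: seg_Re closed_segment_eq_real_ivl split: if_splits)
    moreover have "contour_integral (linepath (Complex (- c) (\<sigma> * r)) (Complex 0 (\<sigma> * r))) (g \<sigma>)
        = I (Complex (- c) (\<sigma> * r)) (Complex 0 (\<sigma> * r))"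
      using r \<sigma> by (intro line) (auto simp: seg_Im)
    moreover have "contour_integral (linepath (Complex 0 (\<sigma> * r)) 0) (g \<sigma>) = I (Complex 0 (\<sigma> * r)) 0"
      using r \<sigma> by (intro line) (auto simp: zero seg_Re closed_segment_eq_real_ivl split: if_splits)
    ultimately show ?thesis
      using half_plane_loop[OF \<sigma> \<rho> r c, of \<alpha> s, folded g_def] unfolding loop_def cut_def by simp
  qed
  have rect: "contour_integral ?rect ?H = I (Complex (- c) (- r)) (Complex 0 (- r)) + I (Complex 0 (- r)) (Complex 0 r)
          + I (Complex 0 r) (Complex (- c) r) + I (Complex (- c) r) (Complex (- c) (- r))"
    unfolding I_def using r c by (intro contour_integral_rectpath continuous_on_rectpath_h_exp)
  have right_side: "I (Complex 0 (- r)) (Complex 0 r) = I (Complex 0 (- r)) 0 + I 0 (Complex 0 r)"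
    unfolding I_def using r
    by (intro contour_integral_split_linepath cont_H) (auto simp: zero seg_Re closed_segment_eq_real_ivl)
  have left_side: "I (Complex (- c) r) (Complex (- c) (- r)) =
      I (Complex (- c) r) (Complex (- c) 0) + I (Complex (- c) 0) (Complex (- c) (- r))"
    unfolding I_def using r c
    by (intro contour_integral_split_linepath cont_H) (auto simp: seg_Re closed_segment_eq_real_ivl)
  \<comment> \<open>Adding the difference of the two vanishing loops makes this an identity between integrals over
    segments and arcs, up to orientation.\<close>
  have "contour_integral ?rect ?H = contour_integral ?circ ?H + cut 1 - cut (-1) + (loop (-1) - loop 1)"
    unfolding rect right_side left_side circle loop_def I_rev[of 0 "Complex 0 r"]
      I_rev[of "Complex 0 r" "Complex (- c) r"] I_rev[of "Complex (- c) r" "Complex (- c) 0"]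
    by simp
  then have "contour_integral ?rect ?H = contour_integral ?circ ?H + cut 1 - cut (-1)"
    using loop[of 1] loop[of "-1"] by simp
  moreover have "cut \<sigma> = - contour_integral (linepath (of_real (- (1 / \<alpha>))) 0) (g \<sigma>)" for \<sigma>
    using contour_integral_reversepath[of "linepath (of_real (- (1 / \<alpha>))) 0" "g \<sigma>"]
    by (simp add: cut_def \<rho>_def complex_of_real_def)
  ultimately show ?thesis
    by (simp add: g_def)
qed

section \<open>The integral along the cut\<close>

definition cut_weight :: "real \<Rightarrow> real \<Rightarrow> real" where
  "cut_weight \<alpha> x = (x / (1 - x)) powr (\<alpha> * x) * sin (\<alpha> * pi * x)"

lemma cut_weight_nonneg:
  assumes "\<alpha> > 1" "x \<in> {0..1 / \<alpha>}"
  shows "0 \<le> cut_weight \<alpha> x"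
proof -
  have "0 \<le> \<alpha> * pi * x" "\<alpha> * pi * x \<le> pi"
    using assms by (auto simp: field_simps)
  then have "0 \<le> sin (\<alpha> * pi * x)"
    by (rule sin_ge_zero)
  then show ?thesis
    unfolding cut_weight_def by simp
qed

lemma less_1_if_on_cut: "\<alpha> > 1 \<Longrightarrow> x \<le> 1 / \<alpha> \<Longrightarrow> x < (1 :: real)"
  by (auto intro: le_less_trans)

lemma continuous_on_branch_cut:
  assumes "\<alpha> > 1" "\<sigma> \<in> {1, -1 :: real}"
  shows "continuous_on {0..1 / \<alpha>} (\<lambda>x. branch \<alpha> (of_real \<sigma> * \<i>) (- of_real x))"
  using assms less_1_if_on_cut[of \<alpha>]
  by (intro continuous_at_imp_continuous_on ballI isCont_o2[OF _ isCont_branch])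
     (auto simp: complex_eq_iff intro!: continuous_intros)

text \<open>At \<open>x = 0\<close> the power in \<open>cut_weight\<close> has the value \<open>0\<close> instead of the limit \<open>1\<close>, but the sine
  vanishes there, so that the weight inherits its continuity from the branch.\<close>

lemma cut_weight_eq_Im_branch:
  assumes "\<alpha> > 1" "x \<in> {0..1 / \<alpha>}"
  shows "cut_weight \<alpha> x = Im (branch \<alpha> \<i> (- of_real x))"
  using assms branch_on_cut[of 1 x \<alpha>] less_1_if_on_cut[of \<alpha> x]
  by (cases "x = 0") (auto simp: cut_weight_def branch_at_zero)

lemma continuous_on_cut_weight:
  assumes "\<alpha> > 1"
  shows "continuous_on {0..1 / \<alpha>} (cut_weight \<alpha>)"
  using continuous_on_branch_cut[OF assms, of 1]
  by (subst continuous_on_cong[OF refl cut_weight_eq_Im_branch[OF assms]])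
     (auto intro!: continuous_intros)

text \<open>On the segment the two boundary values of \<open>h_fun \<alpha>\<close> are complex conjugate, so the lower
  one minus the upper one is \<open>-2 \<i>\<close> times the imaginary part of the upper one. Division by
  \<open>2 \<pi> \<i>\<close> turns the factor \<open>-2 \<i>\<close> into the \<open>-1/\<pi>\<close> that produces the first term of the formula.\<close>

lemma cut_integrals_difference:
  fixes \<alpha> s :: real
  assumes \<alpha>: "\<alpha> > 1"
  shows "contour_integral (linepath (of_real (- (1 / \<alpha>))) 0) (\<lambda>z. branch \<alpha> (- \<i>) z * exp (of_real s * z))
      - contour_integral (linepath (of_real (- (1 / \<alpha>))) 0) (\<lambda>z. branch \<alpha> \<i> z * exp (of_real s * z))
      = - 2 * \<i> * of_real (integral {0..1 / \<alpha>} (\<lambda>x. cut_weight \<alpha> x * exp (- s * x)))"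
proof -
  define w where "w = cut_weight \<alpha>"
  define G where
    "G \<sigma> x = branch \<alpha> (of_real \<sigma> * \<i>) (- of_real x) * exp (of_real s * (- of_real x))" for \<sigma> x :: real
  note cont = continuous_on_branch_cut[OF \<alpha>]
  note cont_w = continuous_on_cut_weight[OF \<alpha>, folded w_def]
  have cut: "(G \<sigma> has_integral
      contour_integral (linepath (of_real (- (1 / \<alpha>))) 0) (\<lambda>z. branch \<alpha> (of_real \<sigma> * \<i>) z * exp (of_real s * z))) {0..1 / \<alpha>}"
    if "\<sigma> \<in> {1, -1}" for \<sigma>
  proof -
    have "G \<sigma> integrable_on {0..1 / \<alpha>}"
      unfolding G_def using cont[OF that] by (intro integrable_continuous_real continuous_intros)
    moreover have "contour_integral (linepath (of_real (- (1 / \<alpha>))) 0) (\<lambda>z. branch \<alpha> (of_real \<sigma> * \<i>) z * exp (of_real s * z))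
       = integral {- (1 / \<alpha>)..- 0} (\<lambda>x. G \<sigma> (- x))"
      using \<alpha> by (subst contour_integral_linepath_Reals_eq) (auto simp: G_def)
    ultimately show ?thesis
      using Henstock_Kurzweil_Integration.integral_reflect_real[of "1 / \<alpha>" 0 "G \<sigma>"] by (simp only: integrable_integral)
  qed
  have diff: "G (-1) x - G 1 x = - 2 * \<i> * of_real (w x * exp (- s * x))" if "x \<in> {0..1 / \<alpha>}" for x
  proof (cases "x = 0")
    case True
    then show ?thesis
      by (simp add: G_def branch_at_zero w_def cut_weight_def)
  next
    case False
    then have "0 < x" "x < 1"
      using that less_1_if_on_cut[OF \<alpha>, of x] by auto
    then show ?thesis
      using branch_on_cut[of 1 x \<alpha>] branch_on_cut[of "-1" x \<alpha>]
      by (simp add: G_def w_def cut_weight_def complex_eq_iff exp_of_real [symmetric] Re_exp Im_exp)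
  qed
  have "((\<lambda>x. w x * exp (- s * x)) has_integral integral {0..1 / \<alpha>} (\<lambda>x. w x * exp (- s * x))) {0..1 / \<alpha>}"
    using cont_w by (intro integrable_integral integrable_continuous_real continuous_intros)
  then have "((\<lambda>x. - 2 * \<i> * of_real (w x * exp (- s * x))) has_integral
      - 2 * \<i> * of_real (integral {0..1 / \<alpha>} (\<lambda>x. w x * exp (- s * x)))) {0..1 / \<alpha>}"
    by (intro has_integral_mult_right has_integral_of_real)
  then have "((\<lambda>x. G (-1) x - G 1 x) has_integral
      - 2 * \<i> * of_real (integral {0..1 / \<alpha>} (\<lambda>x. w x * exp (- s * x)))) {0..1 / \<alpha>}"
    by (rule has_integral_eq[rotated]) (simp add: diff)
  from has_integral_unique[OF has_integral_diff[OF cut[of "-1"] cut[of 1]] this]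
  show ?thesis
    by (simp add: w_def)
qed

section \<open>Laplace transforms of nonnegative functions\<close>

text \<open>Differentiation under the integral sign multiplies the integrand by \<open>-x\<close>, so the alternating
  signs of the derivatives are those of \<open>(-x)\<close> to the power \<open>n\<close>.\<close>

lemma completely_monotonic_laplace:
  fixes w :: "real \<Rightarrow> real"
  assumes cont: "continuous_on {0..b} w" and nonneg: "\<And>x. x \<in> {0..b} \<Longrightarrow> 0 \<le> w x"
  shows "completely_monotonic (\<lambda>s. integral {0..b} (\<lambda>x. w x * exp (- s * x)))"
proof -
  define L where "L n s = integral {0..b} (\<lambda>x. (- x) ^ n * w x * exp (- s * x))" for n and s :: real
  have L_deriv: "(L n has_field_derivative L (Suc n) s) (at s)" for n s
  proof -
    have "((\<lambda>s. integral (cbox 0 b) (\<lambda>x. (- x) ^ n * w x * exp (- s * x))) has_field_derivative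
            integral (cbox 0 b) (\<lambda>x. (- x) ^ Suc n * w x * exp (- s * x))) (at s within UNIV)"
    proof (rule leibniz_rule_field_derivative)
      show "continuous_on (UNIV \<times> cbox 0 b) (\<lambda>(s, x). (- x) ^ Suc n * w x * exp (- s * x))"
        unfolding split_def by (intro continuous_intros continuous_on_compose2[OF cont]) auto
      show "(\<lambda>x. (- x) ^ n * w x * exp (- t * x)) integrable_on cbox 0 b" for t
        unfolding box_real(2) using cont by (intro integrable_continuous_real continuous_intros)
      show "((\<lambda>s. (- x) ^ n * w x * exp (- s * x)) has_field_derivative
              (- x) ^ Suc n * w x * exp (- t * x)) (at t within UNIV)" for t x
        by (auto intro!: derivative_eq_intros)
    qed auto
    then show ?thesis
      unfolding L_def [abs_def] box_real(2) by simp
  qed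
  have "deriv (L n) = L (Suc n)" for n
    by (intro ext DERIV_imp_deriv L_deriv)
  then have iter: "(deriv ^^ n) (L 0) = L n" for n
    by (induction n) simp_all
  have "0 \<le> (- 1) ^ n * L n s" for n s
  proof -
    have "(- 1) ^ n * L n s = integral {0..b} (\<lambda>x. x ^ n * w x * exp (- s * x))"
      unfolding L_def integral_mult_right[symmetric]
      by (simp add: mult.assoc[symmetric] power_mult_distrib[symmetric])
    also have "0 \<le> \<dots>"
      using nonneg by (intro integral_nonneg integrable_continuous_real continuous_intros cont) auto
    finally show ?thesis .
  qed
  then have "completely_monotonic (L 0)"
    unfolding completely_monotonic_def iter using L_deriv field_differentiable_def by blast
  then show ?thesis
    by (simp only: L_def [abs_def] power_0 mult_1)
qed

section \<open>The formula for the entire function\<close>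

lemma phi_fun_eq_h:
  assumes "r > 0" "c > 1"
  shows "phi_fun r c \<alpha> s = - (1 / (2 * of_real pi * \<i>) *
    contour_integral (rectpath (Complex (- c) (- r)) (Complex 0 r)) (\<lambda>z. h_fun \<alpha> z * exp (s * z)))"
proof -
  define R where "R = rectpath (Complex (- c) (- r)) (Complex 0 r)"
  have h: "(\<lambda>z. h_fun \<alpha> z * exp (s * z)) contour_integrable_on R"
    unfolding R_def
    by (intro contour_integrable_continuous_rectpath continuous_on_rectpath_h_exp assms)
  have "((\<lambda>z. exp (of_real \<alpha>) * exp (s * z)) has_contour_integral 0) R"
    unfolding R_def by (rule Cauchy_theorem_convex_simple[of _ UNIV]) (auto intro!: holomorphic_intros)
  moreover have f_eq: "f_fun \<alpha> z * exp (s * z) = exp (of_real \<alpha>) * exp (s * z) - h_fun \<alpha> z * exp (s * z)" for z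
    by (simp add: f_fun_def h_fun_def left_diff_distrib)
  ultimately have "((\<lambda>z. f_fun \<alpha> z * exp (s * z)) has_contour_integral - contour_integral R (\<lambda>z. h_fun \<alpha> z * exp (s * z))) R"
    using has_contour_integral_diff[OF _ has_contour_integral_integral[OF h]] by (simp add: f_eq) fastforce
  then show ?thesis
    unfolding phi_fun_def R_def by (simp add: contour_integral_unique)
qed

theorem theorem4p1:
  fixes \<alpha> :: real
  assumes "\<alpha> > 1"
  shows "(\<forall>r c s :: real. r > 0 \<longrightarrow> c > 1 \<longrightarrow> s \<ge> 0 \<longrightarrow>
            phi_fun r c \<alpha> (of_real s) =
              of_real (1 / pi * integral {0..1 / \<alpha>}
                (\<lambda>x. (x / (1 - x)) powr (\<alpha> * x) * sin (\<alpha> * pi * x) * exp (- s * x)))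
              - Phi_fun \<alpha> (of_real s))
       \<and> completely_monotonic
           (\<lambda>s. 1 / pi * integral {0..1 / \<alpha>}
                (\<lambda>x. (x / (1 - x)) powr (\<alpha> * x) * sin (\<alpha> * pi * x) * exp (- s * x)))"
proof (intro conjI allI impI)
  {
    fix r c s :: real
    assume "r > 0" "c > 1" "s \<ge> 0"
    define A where "A = integral {0..1 / \<alpha>} (\<lambda>x. cut_weight \<alpha> x * exp (- s * x))"
    define R where "R = contour_integral (rectpath (Complex (- c) (- r)) (Complex 0 r))
      (\<lambda>z. h_fun \<alpha> z * exp (of_real s * z))"
    define C where "C = contour_integral (circlepath (-1) (1 - 1 / \<alpha>))
      (\<lambda>z. h_fun \<alpha> z * exp (of_real s * z))"
    have "R = C - 2 * \<i> * of_real A"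
      using rectangle_eq_circle_plus_cut[OF assms \<open>r > 0\<close> \<open>c > 1\<close>, of "of_real s"]
        cut_integrals_difference[OF assms, of s]
      unfolding R_def [symmetric] C_def [symmetric] A_def by (simp only: add_diff_eq [symmetric]) simp
    then have "- (1 / (2 * of_real pi * \<i>) * R) = of_real (1 / pi * A) - 1 / (2 * of_real pi * \<i>) * C"
      by (simp add: field_simps)
    then show "phi_fun r c \<alpha> (of_real s) =
              of_real (1 / pi * integral {0..1 / \<alpha>}
                (\<lambda>x. (x / (1 - x)) powr (\<alpha> * x) * sin (\<alpha> * pi * x) * exp (- s * x)))
              - Phi_fun \<alpha> (of_real s)"
      using phi_fun_eq_h[OF \<open>r > 0\<close> \<open>c > 1\<close>, of \<alpha> "of_real s"]
      unfolding Phi_fun_def A_def R_def C_def cut_weight_def by simp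
  }
  have "completely_monotonic (\<lambda>s. integral {0..1 / \<alpha>} (\<lambda>x. cut_weight \<alpha> x / pi * exp (- s * x)))"
    using continuous_on_cut_weight[OF assms] cut_weight_nonneg[OF assms]
    by (intro completely_monotonic_laplace continuous_intros) auto
  then show "completely_monotonic
           (\<lambda>s. 1 / pi * integral {0..1 / \<alpha>}
                (\<lambda>x. (x / (1 - x)) powr (\<alpha> * x) * sin (\<alpha> * pi * x) * exp (- s * x)))"
    unfolding cut_weight_def integral_mult_right[symmetric] by simp
qed

end
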